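(* Let $k$ be a commutative field and let $\Lambda$ be the $k[\frac{d}{dt}]$-module defined by generators $w_1,\dots,w_\mu$ and relations $P\,(w_1,\dots,w_\mu)^{\mathsf T}=0$, where $P\in k[\frac{d}{dt}]^{\nu\times\mu}$ is a presentation matrix. If $P$ is square, i.e. $\mu=\nu$, then $\Lambda$ is torsion if and only if $\det(P)\neq0$.
   Context: $k[\frac{d}{dt}]$ is the ring of linear differential operators $\sum_{\rm finite}a_\alpha\frac{d^\alpha}{dt^\alpha}$, $a_\alpha\in k$, i.e. a polynomial ring in one indeterminate. Explicitly $\Lambda=\mathfrak{F}/\mathfrak{E}$, where $\mathfrak{F}$ is the free module with basis $W_1,\dots,W_\mu$ and $\mathfrak{E}$ is the submodule spanned by $\sum_{\kappa=1}^{\mu}a_{\iota\kappa}W_\kappa$, $\iota=1,\dots,\nu$, with $P=(a_{\iota\kappa})$. $\Lambda$ is torsion if for every $\lambda\in\Lambda$ there is a nonzero $\pi\in k[\frac{d}{dt}]$ with $\pi\lambda=0$. *)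

theory Defs
  imports "Jordan_Normal_Form.VS_Connect" "HOL-Algebra.AbelCoset"
begin

text \<open>
  The ring \<open>k[d/dt]\<close> of linear differential operators with coefficients in a field \<open>k\<close> is the
  polynomial ring in the indeterminate \<open>d/dt\<close>; it is rendered as the type \<open>'k poly\<close>, and
  \<open>class_ring\<close> is the same ring as a record structure.
\<close>

text \<open>
  The cosets of \<open>N\<close> in \<open>M\<close>, with the operations defined setwise as for the quotient of a ring by an
  ideal. The multiplicative fields of the module record are meaningless for modules.
\<close>

definition quotient_module ::
    "('r, 'a, 'm) module_scheme \<Rightarrow> 'a set \<Rightarrow> ('r, 'a set) module"
  where "quotient_module M N =
    \<lparr>carrier = a_rcosets\<^bsub>M\<^esub> N, mult = undefined, one = undefined,
      zero = N, add = set_add M,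
      smult = (\<lambda>r X. \<Union>x\<in>X. N +>\<^bsub>M\<^esub> (r \<odot>\<^bsub>M\<^esub> x))\<rparr>"

definition torsion_module ::
    "('r, 'm) ring_scheme \<Rightarrow> ('r, 'a, 'n) module_scheme \<Rightarrow> bool"
  where "torsion_module R M \<longleftrightarrow>
    (\<forall>x\<in>carrier M. \<exists>r\<in>carrier R. r \<noteq> \<zero>\<^bsub>R\<^esub> \<and> r \<odot>\<^bsub>M\<^esub> x = \<zero>\<^bsub>M\<^esub>)"

text \<open>
  A matrix \<open>P\<close> with \<open>\<nu>\<close> rows and \<open>\<mu>\<close> columns presents the module with \<open>\<mu>\<close> generators, namely the
  residue classes of the unit vectors, subject to one relation for each of the \<open>\<nu>\<close> rows of \<open>P\<close>.
\<close>

definition relation_submodule :: "'a::comm_ring_1 mat \<Rightarrow> 'a vec set"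
  where "relation_submodule P =
    LinearCombinations.module.span class_ring (module_vec TYPE('a) (dim_col P)) (set (rows P))"

definition presented_module :: "'a::comm_ring_1 mat \<Rightarrow> ('a, 'a vec set) module"
  where "presented_module P =
    quotient_module (module_vec TYPE('a) (dim_col P)) (relation_submodule P)"

lemma (in Module.module) abelian_subgroup_submodule:
  assumes "Module.submodule N R M"
  shows "abelian_subgroup N M"
  using submodule.axioms(1)[OF assms]
  by (intro abelian_subgroupI3) (auto simp: additive_subgroup_def M.abelian_group_axioms)

lemma (in Module.module) smult_quotient_module:
  assumes N: "Module.submodule N R M" and r: "r \<in> carrier R" and x: "x \<in> carrier M"
  shows "r \<odot>\<^bsub>quotient_module M N\<^esub> (N +>\<^bsub>M\<^esub> x) = N +>\<^bsub>M\<^esub> (r \<odot>\<^bsub>M\<^esub> x)"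
proof -
  interpret N: abelian_subgroup N M by (rule abelian_subgroup_submodule[OF N])
  have eq: "N +>\<^bsub>M\<^esub> (r \<odot>\<^bsub>M\<^esub> y) = N +>\<^bsub>M\<^esub> (r \<odot>\<^bsub>M\<^esub> x)" if "y \<in> N +>\<^bsub>M\<^esub> x" for y
  proof -
    from that obtain h where h: "h \<in> N" and y: "y = h \<oplus>\<^bsub>M\<^esub> x"
      by (auto simp: a_r_coset_def r_coset_def)
    have "r \<odot>\<^bsub>M\<^esub> y = r \<odot>\<^bsub>M\<^esub> h \<oplus>\<^bsub>M\<^esub> r \<odot>\<^bsub>M\<^esub> x"
      unfolding y using r x h submoduleE(1)[OF N] by (intro smult_r_distr) auto
    then have "r \<odot>\<^bsub>M\<^esub> y \<in> N +>\<^bsub>M\<^esub> (r \<odot>\<^bsub>M\<^esub> x)"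
      using submoduleE(4)[OF N r h] by (auto simp: a_r_coset_def r_coset_def)
    then show ?thesis
      by (rule N.a_repr_independence'[symmetric]) (rule smult_closed[OF r x])
  qed
  have "x \<in> N +>\<^bsub>M\<^esub> x" using x by (rule N.a_rcos_self)
  then have "(\<Union>y\<in>N +>\<^bsub>M\<^esub> x. N +>\<^bsub>M\<^esub> (r \<odot>\<^bsub>M\<^esub> y)) = N +>\<^bsub>M\<^esub> (r \<odot>\<^bsub>M\<^esub> x)"
    using eq by blast
  then show ?thesis by (simp add: quotient_module_def)
qed

lemma (in Module.module) module_quotient_module:
  assumes N: "Module.submodule N R M"
  shows "Module.module R (quotient_module M N)"
proof -
  interpret N: abelian_subgroup N M by (rule abelian_subgroup_submodule[OF N])
  let ?Q = "quotient_module M N"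
  have car: "\<exists>x\<in>carrier M. X = N +>\<^bsub>M\<^esub> x" if "X \<in> carrier ?Q" for X
    using that by (auto simp: quotient_module_def A_RCOSETS_def')
  have mem: "N +>\<^bsub>M\<^esub> x \<in> carrier ?Q" if "x \<in> carrier M" for x
    using that M.a_rcosetsI[OF submoduleE(1)[OF N]] by (simp add: quotient_module_def)
  have add: "(N +>\<^bsub>M\<^esub> x) \<oplus>\<^bsub>?Q\<^esub> (N +>\<^bsub>M\<^esub> y) = N +>\<^bsub>M\<^esub> (x \<oplus>\<^bsub>M\<^esub> y)"
    if "x \<in> carrier M" "y \<in> carrier M" for x y
    using that by (simp add: quotient_module_def N.a_rcos_sum)
  have zero: "\<zero>\<^bsub>?Q\<^esub> = N +>\<^bsub>M\<^esub> \<zero>\<^bsub>M\<^esub>"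
    using submoduleE(1)[OF N] by (simp add: quotient_module_def M.a_coset_add_zero)
  have "abelian_group ?Q"
  proof (rule abelian_groupI)
    fix X assume "X \<in> carrier ?Q"
    then obtain x where x: "x \<in> carrier M" "X = N +>\<^bsub>M\<^esub> x" using car by blast
    have "(N +>\<^bsub>M\<^esub> (\<ominus>\<^bsub>M\<^esub> x)) \<oplus>\<^bsub>?Q\<^esub> X = \<zero>\<^bsub>?Q\<^esub>"
      unfolding zero x(2) using x(1) by (simp only: add M.a_inv_closed M.l_neg)
    then show "\<exists>Y\<in>carrier ?Q. Y \<oplus>\<^bsub>?Q\<^esub> X = \<zero>\<^bsub>?Q\<^esub>"
      using mem[OF M.a_inv_closed[OF x(1)]] by blast
  next
    fix X Y assume "X \<in> carrier ?Q" "Y \<in> carrier ?Q"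
    then obtain x y where xy: "x \<in> carrier M" "X = N +>\<^bsub>M\<^esub> x"
      "y \<in> carrier M" "Y = N +>\<^bsub>M\<^esub> y" using car by blast
    show "X \<oplus>\<^bsub>?Q\<^esub> Y \<in> carrier ?Q" using xy by (simp add: add mem)
    show "X \<oplus>\<^bsub>?Q\<^esub> Y = Y \<oplus>\<^bsub>?Q\<^esub> X" using xy by (simp add: add M.a_comm)
    fix Z assume "Z \<in> carrier ?Q"
    then obtain z where "z \<in> carrier M" "Z = N +>\<^bsub>M\<^esub> z" using car by blast
    with xy show "X \<oplus>\<^bsub>?Q\<^esub> Y \<oplus>\<^bsub>?Q\<^esub> Z = X \<oplus>\<^bsub>?Q\<^esub> (Y \<oplus>\<^bsub>?Q\<^esub> Z)"
      by (simp add: add M.a_assoc)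
  next
    show "\<zero>\<^bsub>?Q\<^esub> \<in> carrier ?Q" unfolding zero by (rule mem) simp
    fix X assume "X \<in> carrier ?Q"
    then obtain x where x: "x \<in> carrier M" "X = N +>\<^bsub>M\<^esub> x" using car by blast
    show "\<zero>\<^bsub>?Q\<^esub> \<oplus>\<^bsub>?Q\<^esub> X = X" unfolding zero x(2) using x(1) by (simp only: add M.zero_closed M.l_zero)
  qed
  then show ?thesis
  proof (rule moduleI[OF R.is_cring])
    fix X assume "X \<in> carrier ?Q"
    then obtain x where x: "x \<in> carrier M" "X = N +>\<^bsub>M\<^esub> x" using car by blast
    show "\<one>\<^bsub>R\<^esub> \<odot>\<^bsub>?Q\<^esub> X = X"
      using x by (simp add: smult_quotient_module[OF N])
    fix a assume a: "a \<in> carrier R"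
    show "a \<odot>\<^bsub>?Q\<^esub> X \<in> carrier ?Q"
      using x a by (simp add: smult_quotient_module[OF N] mem)
    fix b assume b: "b \<in> carrier R"
    show "(a \<oplus>\<^bsub>R\<^esub> b) \<odot>\<^bsub>?Q\<^esub> X = a \<odot>\<^bsub>?Q\<^esub> X \<oplus>\<^bsub>?Q\<^esub> b \<odot>\<^bsub>?Q\<^esub> X"
      using x a b by (simp add: smult_quotient_module[OF N] add smult_l_distr)
    show "(a \<otimes>\<^bsub>R\<^esub> b) \<odot>\<^bsub>?Q\<^esub> X = a \<odot>\<^bsub>?Q\<^esub> (b \<odot>\<^bsub>?Q\<^esub> X)"
      using x a b by (simp add: smult_quotient_module[OF N] smult_assoc1)
  next
    fix a X Y assume a: "a \<in> carrier R" and "X \<in> carrier ?Q" "Y \<in> carrier ?Q"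
    then obtain x y where x: "x \<in> carrier M" "X = N +>\<^bsub>M\<^esub> x"
      and y: "y \<in> carrier M" "Y = N +>\<^bsub>M\<^esub> y" using car by blast
    show "a \<odot>\<^bsub>?Q\<^esub> (X \<oplus>\<^bsub>?Q\<^esub> Y) = a \<odot>\<^bsub>?Q\<^esub> X \<oplus>\<^bsub>?Q\<^esub> a \<odot>\<^bsub>?Q\<^esub> Y"
      using x y a by (simp add: smult_quotient_module[OF N] add smult_r_distr)
  qed
qed

lemma submodule_relation_submodule:
  fixes P :: "'a::comm_ring_1 mat"
  shows "Module.submodule (relation_submodule P) class_ring (module_vec TYPE('a) (dim_col P))"
proof -
  interpret vec_module "TYPE('a)" "dim_col P" .
  have V: "Module.module class_ring V" by (rule module_axioms)
  have "LinearCombinations.submodule class_ring (relation_submodule P) V"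
    unfolding relation_submodule_def
    by (rule LinearCombinations.module.span_is_submodule[OF V]) (auto simp: module_vec_simps rows_def)
  then have "Module.module class_ring (V\<lparr>carrier := relation_submodule P\<rparr>)"
    and "relation_submodule P \<subseteq> carrier V"
    by (auto intro: LinearCombinations.module.submodule_is_module[OF V]
        dest: LinearCombinations.submodule.subset)
  then show ?thesis
    by (intro Module.module.module_incl_imp_submodule[OF V])
qed

lemma module_presented_module: "Module.module class_ring (presented_module P)"
proof -
  interpret vec_module "TYPE('a)" "dim_col P" .
  show ?thesis
    unfolding presented_module_def
    by (rule module.module_quotient_module[OF module_axioms submodule_relation_submodule])
qed

end

theory Submission
  imports Defs
begin

text \<open>
  Every relation has the form \<open>P\<^sup>T u\<close>, so \<open>\<Lambda>\<close> is torsion iff every vector \<open>v\<close> has a nonzero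
  multiple of this form. If \<open>det P \<noteq> 0\<close>, then \<open>P\<^sup>T (adj(P\<^sup>T) v) = det P \<cdot> v\<close> exhibits one. If
  \<open>det P = 0\<close>, some \<open>z \<noteq> 0\<close> has \<open>P z = 0\<close>, so \<open>z\<close> is orthogonal to all relations; a nonzero
  multiple \<open>r e\<^sub>i\<close> with \<open>z\<^sub>i \<noteq> 0\<close> has scalar product \<open>r z\<^sub>i \<noteq> 0\<close> with \<open>z\<close> and is thus never a relation.
\<close>

text \<open>A coset is the zero of the quotient exactly when its representative lies in
  \<open>N\<close>, so torsion can be tested on representatives.\<close>

lemma (in Module.module) torsion_quotient_module_iff:
  assumes N: "Module.submodule N R M"
  shows "torsion_module R (quotient_module M N) \<longleftrightarrow>
    (\<forall>x\<in>carrier M. \<exists>r\<in>carrier R. r \<noteq> \<zero>\<^bsub>R\<^esub> \<and> r \<odot>\<^bsub>M\<^esub> x \<in> N)"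
proof -
  interpret N: abelian_subgroup N M by (rule abelian_subgroup_submodule[OF N])
  have coset: "N +>\<^bsub>M\<^esub> y = N \<longleftrightarrow> y \<in> N" if "y \<in> carrier M" for y
    using that N.a_rcos_self N.a_rcos_const by blast
  have "r \<odot>\<^bsub>quotient_module M N\<^esub> (N +>\<^bsub>M\<^esub> x) = \<zero>\<^bsub>quotient_module M N\<^esub> \<longleftrightarrow> r \<odot>\<^bsub>M\<^esub> x \<in> N"
    if "r \<in> carrier R" "x \<in> carrier M" for r x
    using that by (simp add: smult_quotient_module[OF N] coset) (simp add: quotient_module_def coset)
  moreover have "carrier (quotient_module M N) = (\<lambda>x. N +>\<^bsub>M\<^esub> x) ` carrier M"
    by (auto simp: quotient_module_def A_RCOSETS_def')
  ultimately show ?thesis by (simp add: torsion_module_def cong: bex_cong)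
qed

text \<open>The rows of \<open>P\<close> are the columns of \<open>P\<^sup>T\<close>, so the entries
  of \<open>u\<close> serve as the coefficients of a combination of relations.\<close>

lemma relation_submodule_eq_image:
  fixes P :: "'a::idom mat"
  assumes P: "P \<in> carrier_mat m n"
  shows "relation_submodule P = (\<lambda>u. P\<^sup>T *\<^sub>v u) ` carrier_vec m"
proof -
  interpret idom_vec n "TYPE('a)" .
  have rows: "set (rows P) \<subseteq> carrier_vec n" using P by (auto simp: rows_def)
  have lincomb: "lincomb_list c (rows P) = P\<^sup>T *\<^sub>v vec m c" for c
  proof -
    have "lincomb_list c (rows P) = mat_of_cols n (cols P\<^sup>T) *\<^sub>v vec (length (rows P)) c"
      using rows by (subst lincomb_list_as_mat_mult) auto
    also have "mat_of_cols n (cols P\<^sup>T) = P\<^sup>T"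
      using P mat_of_cols_cols[of "P\<^sup>T"] by simp
    finally show ?thesis using P by simp
  qed
  have "relation_submodule P = span_list (rows P)"
    using P span_list_as_span[OF rows] by (simp add: relation_submodule_def)
  also have "\<dots> = range (\<lambda>c. P\<^sup>T *\<^sub>v vec m c)"
    by (auto simp: span_list_def lincomb)
  also have "\<dots> = (\<lambda>u. P\<^sup>T *\<^sub>v u) ` range (vec m)" by (simp add: image_image)
  \<comment> \<open>Coefficients come as functions on all naturals, of which \<open>vec m\<close>
    keeps the first \<open>m\<close> values; a given vector arises from its own entry
    function.\<close>
  also have "range (vec m) = (carrier_vec m :: 'a vec set)"
  proof (intro equalityI subsetI)
    fix u :: "'a vec" assume "u \<in> carrier_vec m"
    then have "u = vec m (($) u)" by auto
    then show "u \<in> range (vec m)" by blast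
  qed auto
  finally show ?thesis .
qed

lemma torsion_presented_module_iff:
  fixes P :: "'a::idom mat"
  assumes P: "P \<in> carrier_mat m n"
  shows "torsion_module class_ring (presented_module P) \<longleftrightarrow>
    (\<forall>v\<in>carrier_vec n. \<exists>r u. r \<noteq> 0 \<and> u \<in> carrier_vec m \<and> r \<cdot>\<^sub>v v = P\<^sup>T *\<^sub>v u)"
proof -
  interpret vec_module "TYPE('a)" "dim_col P" .
  show ?thesis
    using P module.torsion_quotient_module_iff[OF module_axioms submodule_relation_submodule]
    by (auto simp: presented_module_def module_vec_simps relation_submodule_eq_image[OF P] image_iff Bex_def)
qed

text \<open>The single scalar \<open>det P\<close> annihilates every residue class.\<close>

lemma torsion_presented_module_if_det_nonzero:
  fixes P :: "'a::idom mat"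
  assumes P: "P \<in> carrier_mat n n" and det: "det P \<noteq> 0"
  shows "torsion_module class_ring (presented_module P)"
  unfolding torsion_presented_module_iff[OF P]
proof
  fix v :: "'a vec" assume v: "v \<in> carrier_vec n"
  have PT: "P\<^sup>T \<in> carrier_mat n n" using P by simp
  note adj = adj_mat[OF PT]
  have "P\<^sup>T *\<^sub>v (adj_mat P\<^sup>T *\<^sub>v v) = (det P \<cdot>\<^sub>m 1\<^sub>m n) *\<^sub>v v"
    using assoc_mult_mat_vec[OF PT adj(1) v] adj(2) det_transpose[OF P] by simp
  also have "\<dots> = det P \<cdot>\<^sub>v v" using v by (intro eq_vecI) auto
  finally show "\<exists>r u. r \<noteq> 0 \<and> u \<in> carrier_vec n \<and> r \<cdot>\<^sub>v v = P\<^sup>T *\<^sub>v u"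
    using det adj(1) v by (intro exI[of _ "det P"] exI[of _ "adj_mat P\<^sup>T *\<^sub>v v"]) auto
qed

lemma det_nonzero_if_torsion_presented_module:
  fixes P :: "'a::idom mat"
  assumes P: "P \<in> carrier_mat n n" and torsion: "torsion_module class_ring (presented_module P)"
  shows "det P \<noteq> 0"
proof
  assume "det P = 0"
  \<comment> \<open>Over a domain such a \<open>z\<close> comes from a kernel vector over the
    fraction field by clearing denominators.\<close>
  then obtain z where z: "z \<in> carrier_vec n" "z \<noteq> 0\<^sub>v n" "P *\<^sub>v z = 0\<^sub>v n"
    using det_0_iff_vec_prod_zero[OF P] by blast
  then obtain i where i: "i < n" "z $ i \<noteq> 0" by (metis carrier_vecD eq_vecI index_zero_vec)
  obtain r u where r: "r \<noteq> 0" and u: "u \<in> carrier_vec n"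
    and eq: "r \<cdot>\<^sub>v unit_vec n i = P\<^sup>T *\<^sub>v u"
    using torsion unfolding torsion_presented_module_iff[OF P] by (meson unit_vec_carrier)
  \<comment> \<open>Pairing with \<open>z\<close> moves the transpose across the scalar product,
    where \<open>P\<close> kills \<open>z\<close>; the left side is nonzero for lack of zero
    divisors.\<close>
  have "r * z $ i = (r \<cdot>\<^sub>v unit_vec n i) \<bullet> z" using z(1) i(1) by simp
  also have "\<dots> = u \<bullet> (P *\<^sub>v z)"
    unfolding eq by (rule transpose_vec_mult_scalar[OF P z(1) u])
  also have "\<dots> = 0" using u by (simp add: z(3))
  finally show False using r i(2) by simp
qed

theorem corollary11:
  fixes P :: "'k::field poly mat" and \<nu> \<mu> :: nat
  assumes "P \<in> carrier_mat \<nu> \<mu>" and "\<mu> = \<nu>"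
  shows "torsion_module class_ring (presented_module P) \<longleftrightarrow> det P \<noteq> 0"
  using assms torsion_presented_module_if_det_nonzero det_nonzero_if_torsion_presented_module
  by blast

end
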